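(* Let $\mathcal X\in\mathrm{Gr}(n,k)$ and let $0\le\theta_1\le\cdots\le\theta_k<\pi/2$ be the principal angles between $\mathcal X$ and $\mathcal V_\alpha$. Then $$f(\mathcal X)-f^*\ge c_Q\,\delta\,\mathrm{dist}^2(\mathcal X,\mathcal V_\alpha),$$ where $c_Q=4/\pi^2>0.4$.
   Context: Let $1\le k\le n-1$ and let $A\in\mathbb R^{n\times n}$ be symmetric positive semidefinite with eigenvalues $\lambda_1\ge\cdots\ge\lambda_n$ (with multiplicity) and orthonormal eigenvectors $v_1,\dots,v_n$, $Av_i=\lambda_iv_i$. Put $\delta=\lambda_k-\lambda_{k+1}\ge0$ and $\mathcal V_\alpha=\mathrm{span}(v_1,\dots,v_k)$ (if $\delta=0$, $\mathcal V_\alpha$ is any fixed subspace spanned by $k$ leading eigenvectors). $\mathrm{Gr}(n,k)$ is the Grassmann manifold of $k$-dimensional subspaces of $\mathbb R^n$; a subspace $\mathcal X=\mathrm{span}(X)$ is always represented by $X\in\mathbb R^{n\times k}$ with $X^TX=I_k$. The principal angles $0\le\theta_1\le\cdots\le\theta_k\le\pi/2$ between $\mathcal X=\mathrm{span}(X)$ and $\mathcal Y=\mathrm{span}(Y)$ are such that $\cos\theta_1,\dots,\cos\theta_k$ are the singular values of $Y^TX$; the Riemannian distance is $\mathrm{dist}(\mathcal X,\mathcal Y)=\sqrt{\theta_1^2+\cdots+\theta_k^2}$. The objective is $f:\mathrm{Gr}(n,k)\to\mathbb R$, $f(\mathcal X)=-\mathrm{Tr}(X^TAX)$, with global minimum $f^*=-(\lambda_1+\cdots+\lambda_k)$.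 *)

theory Defs
  imports
    Complex_Main
    "Jordan_Normal_Form.Schur_Decomposition"
    "Jordan_Normal_Form.DL_Rank"
begin

abbreviation real_vs :: "nat \<Rightarrow> (real, real vec) module" where
  "real_vs n \<equiv> module_vec TYPE(real) n"

abbreviation real_span :: "nat \<Rightarrow> real vec set \<Rightarrow> real vec set" where
  "real_span n S \<equiv> LinearCombinations.module.span class_ring (real_vs n) S"

definition Gr :: "nat \<Rightarrow> nat \<Rightarrow> real vec set set" where
  "Gr n k = {\<X>. VectorSpace.subspace class_ring \<X> (real_vs n) \<and>
                 vectorspace.dim class_ring ((real_vs n)\<lparr>carrier := \<X>\<rparr>) = k}"

text \<open>\<open>represents n k X \<X>\<close>: the columns of \<open>X\<close> form an orthonormal basis of \<open>\<X>\<close>.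
  The functions of subspaces below are evaluated at an arbitrarily chosen representative;
  \<open>objective_eq\<close> and \<open>principal_angles_eq\<close> show that every representative gives the same value, and
  \<open>Gr_represented\<close> and \<open>represents_Gr\<close> show that exactly the elements of \<open>Gr n k\<close> are
  represented.\<close>

definition represents :: "nat \<Rightarrow> nat \<Rightarrow> real mat \<Rightarrow> real vec set \<Rightarrow> bool" where
  "represents n k X \<X> \<longleftrightarrow>
     X \<in> carrier_mat n k \<and> X\<^sup>T * X = 1\<^sub>m k \<and> real_span n (set (cols X)) = \<X>"

definition frame_of :: "nat \<Rightarrow> nat \<Rightarrow> real vec set \<Rightarrow> real mat" where
  "frame_of n k \<X> = (SOME X. represents n k X \<X>)"

definition mat_trace :: "real mat \<Rightarrow> real" where
  "mat_trace M = (\<Sum>i<dim_row M. M $$ (i, i))"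

definition objective :: "nat \<Rightarrow> nat \<Rightarrow> real mat \<Rightarrow> real vec set \<Rightarrow> real" where
  "objective n k A \<X> = - mat_trace ((frame_of n k \<X>)\<^sup>T * A * frame_of n k \<X>)"

text \<open>Square roots of the eigenvalues of \<open>M\<^sup>T M\<close>, with algebraic multiplicity and in decreasing
  order, one for each column of \<open>M\<close> (\<open>length_singular_values\<close>).\<close>

definition singular_values :: "real mat \<Rightarrow> real list" where
  "singular_values M =
     rev (sorted_list_of_multiset (image_mset sqrt (proots (char_poly (M\<^sup>T * M)))))"

text \<open>In increasing order; see \<open>principal_angles_props\<close>.\<close>

definition principal_angles :: "nat \<Rightarrow> nat \<Rightarrow> real vec set \<Rightarrow> real vec set \<Rightarrow> real list" where
  "principal_angles n k \<X> \<Y> =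
     map arccos (singular_values ((frame_of n k \<Y>)\<^sup>T * frame_of n k \<X>))"

definition gr_dist :: "nat \<Rightarrow> nat \<Rightarrow> real vec set \<Rightarrow> real vec set \<Rightarrow> real" where
  "gr_dist n k \<X> \<Y> = sqrt (\<Sum>\<theta>\<leftarrow>principal_angles n k \<X> \<Y>. \<theta>\<^sup>2)"

lemma represents_span:
  assumes X: "X \<in> carrier_mat n k"
  shows "real_span n (set (cols X)) = {X *\<^sub>v c | c. c \<in> carrier_vec k}"
  using vec_space.col_space_eq[OF X] X
  unfolding vec_space.col_space_def by auto

lemma Gr_represented:
  assumes "\<X> \<in> Gr n k"
  shows "\<exists>X. represents n k X \<X>"
proof -
  interpret cof_vec_space n "TYPE(real)" .
  have sub: "VectorSpace.subspace class_ring \<X> V"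
    and dimk: "vectorspace.dim class_ring (V\<lparr>carrier := \<X>\<rparr>) = k"
    using assms unfolding Gr_def by auto
  have subm: "submodule class_ring \<X> V" using sub unfolding VectorSpace.subspace_def by auto
  have Xn: "\<X> \<subseteq> carrier_vec n" using subm unfolding submodule_def by auto
  have "\<exists>B. finite B \<and> maximal B (\<lambda>B. B \<subseteq> \<X> \<and> lin_indpt B)"
  proof (rule maximal_exists[where N=n and B="{}"])
    fix B assume "B \<subseteq> \<X> \<and> lin_indpt B"
    then show "finite B \<and> card B \<le> n" using li_le_dim[of B] Xn dim_is_n by auto
  qed (auto simp: lin_dep_def)
  then obtain B where fB: "finite B" and mB: "maximal B (\<lambda>B. B \<subseteq> \<X> \<and> lin_indpt B)" by auto
  have BX: "B \<subseteq> \<X>" and Bl: "lin_indpt B" using mB unfolding maximal_def by auto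
  have Bn: "B \<subseteq> carrier_vec n" using BX Xn by auto
  have "span B \<subseteq> \<X>" using span_is_subset[OF BX subm] .
  moreover have "\<X> \<subseteq> span B"
  proof
    fix x assume x: "x \<in> \<X>"
    show "x \<in> span B"
    proof (rule ccontr)
      assume n: "x \<notin> span B"
      have "x \<notin> B" using n span_mem[OF Bn] by auto
      have "lin_indpt (B \<union> {x})"
        using lin_dep_iff_in_span[OF Bn Bl, of x] n x Xn \<open>x \<notin> B\<close> by auto
      then have "B \<union> {x} = B" using mB BX x unfolding maximal_def by auto
      then show False using \<open>x \<notin> B\<close> by auto
    qed
  qed
  ultimately have sp: "span B = \<X>" by auto
  have vs: "vectorspace class_ring (V\<lparr>carrier := \<X>\<rparr>)"
    using subspace_is_vs[OF sub] .
  have "vectorspace.basis class_ring (V\<lparr>carrier := \<X>\<rparr>) B"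
    unfolding vectorspace.basis_def[OF vs]
    using span_li_not_depend[OF BX subm] sp BX Bl by auto
  then have cB: "card B = k" using vectorspace.dim_basis[OF vs fB] dimk by auto
  obtain ws where ws: "set ws = B" "distinct ws" using finite_distinct_list[OF fB] by auto
  have lw: "length ws = k" using ws cB distinct_card by fastforce
  define us where "us = gram_schmidt n ws"
  note gs = gram_schmidt_result[OF _ ws(2) _ us_def]
  have us: "span (set us) = \<X>" "corthogonal us" "set us \<subseteq> carrier_vec n" "length us = k"
    using gs ws Bn Bl sp lw by auto
  have orth: "us ! i \<bullet> us ! j = 0 \<longleftrightarrow> i \<noteq> j" if "i < k" "j < k" for i j
  proof -
    have "conjugate (us ! j) = us ! j" by (intro eq_vecI) auto
    then show ?thesis using corthogonalD[OF us(2), of i j] us(4) that by simp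
  qed
  have pos: "us ! i \<bullet> us ! i > 0" if "i < k" for i
  proof -
    have "us ! i \<bullet> us ! i \<ge> 0" by (simp add: scalar_prod_def sum_nonneg)
    then show ?thesis using orth[OF that that] by linarith
  qed
  define ys where "ys = map (\<lambda>u. (1 / sqrt (u \<bullet> u)) \<cdot>\<^sub>v u) us"
  define X where "X = mat_of_cols n ys"
  have usi: "us ! i \<in> carrier_vec n" if "i < k" for i using us(3,4) that by auto
  have ysn: "set ys \<subseteq> carrier_vec n" using us(3) unfolding ys_def by auto
  have ly: "length ys = k" using us(4) unfolding ys_def by auto
  have yi: "ys ! i = (1 / sqrt (us ! i \<bullet> us ! i)) \<cdot>\<^sub>v us ! i" if "i < k" for i
    using that us(4) unfolding ys_def by auto
  have X: "X \<in> carrier_mat n k" unfolding X_def using ly by auto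
  have cX: "cols X = ys" unfolding X_def using ysn by auto
  have "X\<^sup>T * X = 1\<^sub>m k"
  proof (rule eq_matI)
    fix i j assume "i < dim_row (1\<^sub>m k)" "j < dim_col (1\<^sub>m k)"
    then have ij: "i < k" "j < k" by auto
    have "(X\<^sup>T * X) $$ (i, j) = ys ! i \<bullet> ys ! j"
      using ij X cX ly by (metis carrier_matD(2) cols_nth dim_col_mat(1) index_mult_mat(1)
          index_transpose_mat(2) row_transpose)
    also have "\<dots> = (1 / sqrt (us ! i \<bullet> us ! i)) * ((1 / sqrt (us ! j \<bullet> us ! j)) * (us ! i \<bullet> us ! j))"
      unfolding yi[OF ij(1)] yi[OF ij(2)]
      using scalar_prod_smult_left[of "us ! i" "1 / sqrt (us ! j \<bullet> us ! j) \<cdot>\<^sub>v us ! j"]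
        scalar_prod_smult_right[of "us ! i" "us ! j"] usi[OF ij(1)] usi[OF ij(2)] by simp
    also have "\<dots> = 1\<^sub>m k $$ (i, j)"
    proof (cases "i = j")
      case True
      then show ?thesis using ij pos[of j]
        by (simp add: real_sqrt_mult_self field_simps flip: power2_eq_square)
    next
      case False
      then show ?thesis using ij orth[of i j] by simp
    qed
    finally show "(X\<^sup>T * X) $$ (i, j) = 1\<^sub>m k $$ (i, j)" .
  qed (use X in auto)
  moreover have "span (set ys) = \<X>"
  proof
    have "set ys \<subseteq> span (set us)"
      unfolding ys_def using us(3) span_mem[OF us(3)] smult_in_span[OF us(3)] by auto
    then show "span (set ys) \<subseteq> \<X>" using us(1) span_is_subset[OF _ subm] by auto
    have "us ! i \<in> span (set ys)" if "i < k" for i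
    proof -
      have "us ! i = sqrt (us ! i \<bullet> us ! i) \<cdot>\<^sub>v ys ! i"
        using pos[OF that] usi[OF that] by (simp add: yi[OF that] smult_smult_assoc)
      moreover have "ys ! i \<in> span (set ys)" using span_mem[OF ysn] that ly by auto
      ultimately show ?thesis using smult_in_span[OF ysn] by metis
    qed
    then have "set us \<subseteq> span (set ys)" using us(4) by (metis in_set_conv_nth subsetI)
    then have "span (set us) \<subseteq> span (set ys)"
      using span_is_subset[OF _ span_is_submodule[OF ysn]] by auto
    then show "\<X> \<subseteq> span (set ys)" using us(1) by auto
  qed
  ultimately show ?thesis unfolding represents_def using X cX by auto
qed

lemma represents_frame_of: "represents n k X \<X> \<Longrightarrow> represents n k (frame_of n k \<X>) \<X>"
  unfolding frame_of_def by (rule someI)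

lemma mat_trace_comm:
  assumes A: "A \<in> carrier_mat n m" and B: "B \<in> carrier_mat m n"
  shows "mat_trace (A * B) = mat_trace (B * A)"
proof -
  have "mat_trace (A * B) = (\<Sum>i<n. \<Sum>j<m. A $$ (i, j) * B $$ (j, i))"
    unfolding mat_trace_def using A B by (auto simp: scalar_prod_def atLeast0LessThan intro!: sum.cong)
  also have "\<dots> = (\<Sum>j<m. \<Sum>i<n. B $$ (j, i) * A $$ (i, j))"
    by (subst sum.swap) (simp add: mult.commute)
  also have "\<dots> = mat_trace (B * A)"
    unfolding mat_trace_def using A B by (auto simp: scalar_prod_def atLeast0LessThan intro!: sum.cong)
  finally show ?thesis .
qed

lemma represents_change:
  assumes "represents n k X \<X>" "represents n k Y \<X>"
  obtains Q where "Q \<in> carrier_mat k k" "Y = X * Q" "Q\<^sup>T * Q = 1\<^sub>m k" "Q * Q\<^sup>T = 1\<^sub>m k"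
proof -
  have X: "X \<in> carrier_mat n k" "X\<^sup>T * X = 1\<^sub>m k" and Y: "Y \<in> carrier_mat n k" "Y\<^sup>T * Y = 1\<^sub>m k"
    and sp: "real_span n (set (cols X)) = real_span n (set (cols Y))"
    using assms unfolding represents_def by auto
  define Q where "Q = X\<^sup>T * Y"
  have Q: "Q \<in> carrier_mat k k" unfolding Q_def using X Y by auto
  have XQ: "Y = X * Q"
  proof (rule mat_col_eqI)
    fix j assume "j < dim_col (X * Q)"
    then have j: "j < k" using Q by auto
    have "col Y j = Y *\<^sub>v unit_vec k j"
      using Y(1) j by (intro eq_vecI) (auto simp: scalar_prod_right_unit)
    then have "col Y j \<in> real_span n (set (cols Y))"
      unfolding represents_span[OF Y(1)] using unit_vec_carrier by blast
    then obtain c where c: "c \<in> carrier_vec k" "col Y j = X *\<^sub>v c"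
      unfolding sp[symmetric] represents_span[OF X(1)] by auto
    have "col (X * Q) j = X *\<^sub>v (X\<^sup>T *\<^sub>v (X *\<^sub>v c))"
      unfolding Q_def using X(1) Y(1) j c(2) by (metis col_mult2 mult_carrier_mat transpose_carrier_mat)
    also have "\<dots> = X *\<^sub>v ((X\<^sup>T * X) *\<^sub>v c)" using X(1) c(1) by (subst assoc_mult_mat_vec) auto
    also have "\<dots> = col Y j" using X c by simp
    finally show "col Y j = col (X * Q) j" by simp
  qed (use X Y Q in auto)
  have "Q\<^sup>T * Q = (Y\<^sup>T * X) * Q" unfolding Q_def using X Y by (simp add: transpose_mult[of _ k n])
  also have "\<dots> = Y\<^sup>T * (X * Q)" using X Y Q by (intro assoc_mult_mat) auto
  also have "\<dots> = 1\<^sub>m k" using XQ Y by simp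
  finally have QQ: "Q\<^sup>T * Q = 1\<^sub>m k" .
  moreover have "Q * Q\<^sup>T = 1\<^sub>m k"
    using mat_mult_left_right_inverse[OF _ Q QQ] Q by auto
  ultimately show ?thesis using that Q XQ by auto
qed

lemma objective_eq:
  assumes X: "represents n k X \<X>" and A: "A \<in> carrier_mat n n"
  shows "objective n k A \<X> = - mat_trace (X\<^sup>T * A * X)"
proof -
  let ?R = "frame_of n k \<X>"
  obtain Q where Q: "Q \<in> carrier_mat k k" "?R = X * Q" "Q * Q\<^sup>T = 1\<^sub>m k"
    using represents_change[OF X represents_frame_of[OF X]] by metis
  have Xc: "X \<in> carrier_mat n k" using X unfolding represents_def by auto
  let ?B = "X\<^sup>T * A * X"
  have B: "?B \<in> carrier_mat k k" using Xc A by auto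
  have "?R\<^sup>T * A * ?R = Q\<^sup>T * (?B * Q)"
    unfolding Q(2) using Q(1) Xc A
    by (simp add: transpose_mult[of _ n k] assoc_mult_mat[of _ k k _ k _ k]
        assoc_mult_mat[of _ k k _ n _ n] assoc_mult_mat[of _ k n _ k _ k]
        assoc_mult_mat[of _ k n _ n _ k] assoc_mult_mat[of _ n n _ k _ k]
        assoc_mult_mat[of _ k k _ n _ k])
  then have "mat_trace (?R\<^sup>T * A * ?R) = mat_trace (?B * Q * Q\<^sup>T)"
    using mat_trace_comm[of "Q\<^sup>T" k k "?B * Q"] Q(1) B by simp
  also have "?B * Q * Q\<^sup>T = ?B * 1\<^sub>m k" using Q B by (simp add: assoc_mult_mat[of _ k k _ k _ k])
  also have "\<dots> = ?B" using B by (rule right_mult_one_mat)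
  finally show ?thesis unfolding objective_def by simp
qed

lemma principal_angles_eq:
  assumes X: "represents n k X \<X>" and Y: "represents n k Y \<Y>"
  shows "principal_angles n k \<X> \<Y> = map arccos (singular_values (Y\<^sup>T * X))"
proof -
  obtain P where P: "P \<in> carrier_mat k k" "frame_of n k \<X> = X * P" "P\<^sup>T * P = 1\<^sub>m k" "P * P\<^sup>T = 1\<^sub>m k"
    using represents_change[OF X represents_frame_of[OF X]] by metis
  obtain Q where Q: "Q \<in> carrier_mat k k" "frame_of n k \<Y> = Y * Q" "Q * Q\<^sup>T = 1\<^sub>m k"
    using represents_change[OF Y represents_frame_of[OF Y]] by metis
  have Xc: "X \<in> carrier_mat n k" and Yc: "Y \<in> carrier_mat n k"
    using X Y unfolding represents_def by auto
  define M where "M = Y\<^sup>T * X"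
  let ?N = "(frame_of n k \<Y>)\<^sup>T * frame_of n k \<X>"
  have M: "M \<in> carrier_mat k k" and Mt: "M\<^sup>T \<in> carrier_mat k k" using Xc Yc by (auto simp: M_def)
  have Pt: "P\<^sup>T \<in> carrier_mat k k" and Qt: "Q\<^sup>T \<in> carrier_mat k k" using P Q by auto
  note asc = assoc_mult_mat[of _ k k _ k _ k]
  have N: "?N = Q\<^sup>T * (M * P)"
    unfolding P(2) Q(2) M_def using P(1) Q(1) Xc Yc
    by (simp add: transpose_mult[of _ n k] assoc_mult_mat[of _ k k _ n _ k]
        assoc_mult_mat[of _ k n _ k _ k])
  have "?N\<^sup>T = (M * P)\<^sup>T * Q\<^sup>T\<^sup>T" unfolding N by (rule transpose_mult) (use M P Q in auto)
  also have "\<dots> = P\<^sup>T * M\<^sup>T * Q" using transpose_mult[OF M P(1)] by simp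
  finally have "?N\<^sup>T * ?N = P\<^sup>T * M\<^sup>T * Q * (Q\<^sup>T * (M * P))" by (simp only: N)
  also have "\<dots> = P\<^sup>T * M\<^sup>T * ((Q * Q\<^sup>T) * (M * P))"
    using P(1) Q(1) M Mt Pt Qt by (simp add: asc)
  also have "\<dots> = P\<^sup>T * (M\<^sup>T * M) * P"
    using P(1) Q(1,3) M Mt Pt by (simp add: asc)
  finally have "similar_mat_wit (?N\<^sup>T * ?N) (M\<^sup>T * M) (P\<^sup>T) P"
    using P N Q M by (intro similar_mat_witI[of _ _ k]) auto
  then have "char_poly (?N\<^sup>T * ?N) = char_poly (M\<^sup>T * M)"
    by (intro char_poly_similar) (auto simp: similar_mat_def)
  then show ?thesis unfolding principal_angles_def singular_values_def M_def by simp
qed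

lemma gram_char_poly_splits:
  fixes M :: "real mat"
  assumes M: "M \<in> carrier_mat m k"
  obtains es where "char_poly (M\<^sup>T * M) = (\<Prod>e\<leftarrow>es. [:- e, 1:])" "length es = k"
    "\<And>e. e \<in> set es \<Longrightarrow> e \<ge> 0"
proof -
  let ?c = "map_mat complex_of_real"
  let ?G = "M\<^sup>T * M"
  have G: "?G \<in> carrier_mat k k" using M by auto
  have cG: "?c ?G \<in> carrier_mat k k" using G by auto
  obtain as where as: "char_poly (?c ?G) = (\<Prod>a\<leftarrow>as. [:- a, 1:])" "length as = k"
    using char_poly_factorized[OF cG] by auto
  have real: "a = complex_of_real (Re a) \<and> Re a \<ge> 0" if a: "a \<in> set as" for a
  proof -
    have "poly (char_poly (?c ?G)) a = 0"
      unfolding as(1) using a by (induction as) auto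
    then have "eigenvalue (?c ?G) a" using eigenvalue_root_char_poly[OF cG] by simp
    then obtain w where w: "w \<in> carrier_vec k" "w \<noteq> 0\<^sub>v k" "?c ?G *\<^sub>v w = a \<cdot>\<^sub>v w"
      unfolding eigenvalue_def eigenvector_def using cG G by auto
    have cM: "?c M \<in> carrier_mat m k" using M by auto
    define u where "u = ?c M *\<^sub>v w"
    have u: "u \<in> carrier_vec m" unfolding u_def using cM w(1) by (rule mult_mat_vec_carrier)
    have "?c ?G = (?c M)\<^sup>T * ?c M"
      using M by (intro eq_matI) (auto simp: scalar_prod_def)
    then have "a \<cdot>\<^sub>v w = (?c M)\<^sup>T *\<^sub>v u"
      using assoc_mult_mat_vec[of "(?c M)\<^sup>T" k m "?c M" k w] w(1,3) cM unfolding u_def by simp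
    then have "a * (conjugate w \<bullet> w) = conjugate w \<bullet> ((?c M)\<^sup>T *\<^sub>v u)"
      using scalar_prod_smult_right[of "conjugate w" w a] w(1) by simp
    also have "\<dots> = (?c M *\<^sub>v conjugate w) \<bullet> u"
    proof -
      have "((?c M)\<^sup>T *\<^sub>v u) \<bullet> conjugate w = u \<bullet> (?c M *\<^sub>v conjugate w)"
        by (rule transpose_vec_mult_scalar[OF cM]) (use w u in auto)
      moreover have "?c M *\<^sub>v conjugate w \<in> carrier_vec m"
        using cM w(1) by (intro mult_mat_vec_carrier) auto
      moreover have "(?c M)\<^sup>T *\<^sub>v u \<in> carrier_vec k"
        using transpose_carrier_mat[THEN iffD2, OF cM] u by (rule mult_mat_vec_carrier)
      ultimately show ?thesis
        using comm_scalar_prod[of "conjugate w" k "(?c M)\<^sup>T *\<^sub>v u"]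
          comm_scalar_prod[of u m "?c M *\<^sub>v conjugate w"] u w(1) by simp
    qed
    also have "?c M *\<^sub>v conjugate w = conjugate u"
      unfolding u_def using M w(1) by (intro eq_vecI) (auto simp: scalar_prod_def)
    finally have eq: "a * (conjugate w \<bullet> w) = conjugate u \<bullet> u" .
    have nn: "conjugate x \<bullet> x = complex_of_real (\<Sum>i<dim_vec x. (cmod (x $ i))\<^sup>2)" for x :: "complex vec"
      by (simp add: scalar_prod_def atLeast0LessThan complex_norm_square mult.commute[of "cnj _"] del: of_real_power)
    define N where "N x = (\<Sum>i<dim_vec x. (cmod (x $ i))\<^sup>2)" for x :: "complex vec"
    have "N w \<noteq> 0"
    proof
      assume "N w = 0"
      then have "\<forall>i\<in>{..<dim_vec w}. (cmod (w $ i))\<^sup>2 = 0"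
        unfolding N_def by (subst (asm) sum_nonneg_eq_0_iff) auto
      then have "w = 0\<^sub>v k" using w(1) by (intro eq_vecI) auto
      then show False using w(2) by simp
    qed
    moreover have "N w \<ge> 0" "N u \<ge> 0" unfolding N_def by (auto intro: sum_nonneg)
    moreover have "a * complex_of_real (N w) = complex_of_real (N u)"
      using eq unfolding nn N_def .
    ultimately have "a = complex_of_real (N u / N w)" "N u / N w \<ge> 0"
      by (auto simp: field_simps)
    then show ?thesis by (metis Re_complex_of_real)
  qed
  interpret mr: map_poly_inj_idom_hom complex_of_real ..
  let ?es = "map Re as"
  have "map_poly complex_of_real (char_poly ?G) = (\<Prod>a\<leftarrow>as. [:- a, 1:])"
    by (rule trans[OF of_real_hom.char_poly_hom[OF G, symmetric] as(1)])
  also have "\<dots> = (\<Prod>a\<leftarrow>as. [:- complex_of_real (Re a), 1:])"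
    by (intro arg_cong[of _ _ prod_list] map_cong refl) (use real in metis)
  also have "\<dots> = map_poly complex_of_real (\<Prod>e\<leftarrow>?es. [:- e, 1:])"
    by (simp add: mr.hom_prod_list o_def)
  finally have "char_poly ?G = (\<Prod>e\<leftarrow>?es. [:- e, 1:])" by (rule mr.injectivity)
  moreover have "length ?es = k" using as by simp
  moreover have "e \<ge> 0" if "e \<in> set ?es" for e using that real by auto
  ultimately show ?thesis by (rule that)
qed

lemma proots_linear_factors:
  "proots (\<Prod>e\<leftarrow>es. [:- e, 1:]) = mset es" for es :: "real list"
proof (induction es)
  case (Cons e es)
  let ?p = "\<Prod>e\<leftarrow>es. [:- e, 1:]"
  have "?p \<noteq> 0" by (auto simp: prod_list_zero_iff)
  then have "proots ([:- e, 1:] * ?p) = proots [:- e, 1:] + proots ?p"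
    by (intro proots_mult) auto
  also have "\<dots> = mset (e # es)" unfolding Cons.IH by simp
  finally show ?case by (simp only: list.map prod_list.Cons)
qed simp

lemma length_singular_values:
  assumes M: "M \<in> carrier_mat m k"
  shows "length (singular_values M) = k"
proof -
  obtain es where es: "char_poly (M\<^sup>T * M) = (\<Prod>e\<leftarrow>es. [:- e, 1:])" "length es = k"
    using gram_char_poly_splits[OF M] .
  have p: "proots (char_poly (M\<^sup>T * M)) = mset es"
    unfolding es(1) by (rule proots_linear_factors)
  have "length (sorted_list_of_multiset N) = size N" for N :: "real multiset"
    by (metis mset_sorted_list_of_multiset size_mset)
  then show ?thesis unfolding singular_values_def p using es(2) by simp
qed

lemma singular_values_01:
  assumes X: "represents n k X \<X>" and Y: "represents n k Y \<Y>"
    and s: "s \<in> set (singular_values (Y\<^sup>T * X))"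
  shows "0 \<le> s" "s \<le> 1"
proof -
  have Xc: "X \<in> carrier_mat n k" "X\<^sup>T * X = 1\<^sub>m k" and Yc: "Y \<in> carrier_mat n k" "Y\<^sup>T * Y = 1\<^sub>m k"
    using X Y unfolding represents_def by auto
  define M where "M = Y\<^sup>T * X"
  have M: "M \<in> carrier_mat k k" unfolding M_def using Xc Yc by auto
  have G: "M\<^sup>T * M \<in> carrier_mat k k" using M by auto
  obtain es where es: "char_poly (M\<^sup>T * M) = (\<Prod>e\<leftarrow>es. [:- e, 1:])" "length es = k"
    "\<And>e. e \<in> set es \<Longrightarrow> e \<ge> 0"
    using gram_char_poly_splits[OF M] by blast
  have "proots (char_poly (M\<^sup>T * M)) = mset es" unfolding es(1) by (rule proots_linear_factors)
  then have "set (singular_values M) = sqrt ` set es"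
    unfolding singular_values_def by simp
  then obtain e where e: "e \<in> set es" "s = sqrt e" using s unfolding M_def by auto
  show "0 \<le> s" using e es(3) by simp
  have "poly (\<Prod>e\<leftarrow>es. [:- e, 1:]) e = 0" using e(1) by (induction es) auto
  then have "eigenvalue (M\<^sup>T * M) e" using eigenvalue_root_char_poly[OF G] es(1) by simp
  then obtain w where w: "w \<in> carrier_vec k" "w \<noteq> 0\<^sub>v k" "M\<^sup>T * M *\<^sub>v w = e \<cdot>\<^sub>v w"
    unfolding eigenvalue_def eigenvector_def using M by auto
  have iso: "(Z *\<^sub>v c) \<bullet> (Z *\<^sub>v c) = c \<bullet> c"
    if "Z \<in> carrier_mat n k" "Z\<^sup>T * Z = 1\<^sub>m k" "c \<in> carrier_vec k" for Z :: "real mat" and c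
  proof -
    have "c \<bullet> c = (Z\<^sup>T *\<^sub>v (Z *\<^sub>v c)) \<bullet> c"
      using assoc_mult_mat_vec[of "Z\<^sup>T" k n Z k c] that by simp
    also have "\<dots> = (Z *\<^sub>v c) \<bullet> (Z *\<^sub>v c)"
      using that by (intro transpose_vec_mult_scalar[of _ n k]) auto
    finally show ?thesis by simp
  qed
  define x where "x = X *\<^sub>v w"
  define z where "z = Y\<^sup>T *\<^sub>v x"
  have x: "x \<in> carrier_vec n" unfolding x_def using Xc(1) w(1) by (rule mult_mat_vec_carrier)
  have z: "z \<in> carrier_vec k" unfolding z_def using Yc(1) x by (intro mult_mat_vec_carrier[of _ k n]) auto
  have Yz: "Y *\<^sub>v z \<in> carrier_vec n" using Yc(1) z by (rule mult_mat_vec_carrier)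
  have xx: "x \<bullet> x = w \<bullet> w" unfolding x_def using iso Xc w(1) by simp
  have YzYz: "(Y *\<^sub>v z) \<bullet> (Y *\<^sub>v z) = z \<bullet> z" using iso Yc z by simp
  have "z \<bullet> z = (Y\<^sup>T *\<^sub>v x) \<bullet> z" unfolding z_def ..
  also have "\<dots> = x \<bullet> (Y *\<^sub>v z)" by (rule transpose_vec_mult_scalar[OF Yc(1) z x])
  finally have xYz: "x \<bullet> (Y *\<^sub>v z) = z \<bullet> z" ..
  have nn: "u \<bullet> u \<ge> 0" for u :: "real vec" by (simp add: scalar_prod_def sum_nonneg)
  have d: "(x - Y *\<^sub>v z) \<bullet> (x - Y *\<^sub>v z) = x \<bullet> x - z \<bullet> z"
  proof -
    have "x - Y *\<^sub>v z \<in> carrier_vec n" using x Yz by simp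
    then have "(x - Y *\<^sub>v z) \<bullet> (x - Y *\<^sub>v z) = x \<bullet> (x - Y *\<^sub>v z) - (Y *\<^sub>v z) \<bullet> (x - Y *\<^sub>v z)"
      using x Yz by (intro minus_scalar_prod_distrib)
    also have "\<dots> = (x \<bullet> x - x \<bullet> (Y *\<^sub>v z)) - ((Y *\<^sub>v z) \<bullet> x - (Y *\<^sub>v z) \<bullet> (Y *\<^sub>v z))"
      using scalar_prod_minus_distrib[OF x x Yz] scalar_prod_minus_distrib[OF Yz x Yz] by simp
    also have "\<dots> = x \<bullet> x - z \<bullet> z" using xYz YzYz comm_scalar_prod[OF x Yz] by simp
    finally show ?thesis .
  qed
  have "M *\<^sub>v w = z" unfolding M_def z_def x_def using Xc Yc w(1) by (intro assoc_mult_mat_vec) auto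
  then have "e \<cdot>\<^sub>v w = M\<^sup>T *\<^sub>v z"
    using w(1,3) assoc_mult_mat_vec[of "M\<^sup>T" k k M k w] M by simp
  then have "e * (w \<bullet> w) = (M\<^sup>T *\<^sub>v z) \<bullet> w" using w(1) by (metis scalar_prod_smult_left carrier_vecD)
  also have "\<dots> = z \<bullet> (M *\<^sub>v w)" by (rule transpose_vec_mult_scalar[OF M w(1) z])
  also have "\<dots> = z \<bullet> z" unfolding \<open>M *\<^sub>v w = z\<close> ..
  also have "\<dots> \<le> w \<bullet> w" using d nn[of "x - Y *\<^sub>v z"] xx by simp
  finally have le: "e * (w \<bullet> w) \<le> 1 * (w \<bullet> w)" by simp
  have "w \<bullet> w \<noteq> 0"
  proof
    assume "w \<bullet> w = 0"
    then have "\<forall>i\<in>{0..<dim_vec w}. w $ i * w $ i = 0"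
      unfolding scalar_prod_def by (subst (asm) sum_nonneg_eq_0_iff) auto
    then have "w = 0\<^sub>v k" using w(1) by (intro eq_vecI) auto
    then show False using w(2) by simp
  qed
  then have "w \<bullet> w > 0" using nn[of w] by linarith
  then have "e \<le> 1" using le by (rule mult_right_le_imp_le[rotated])
  then show "s \<le> 1" using e(2) by simp
qed

lemma principal_angles_props:
  assumes X: "represents n k X \<X>" and Y: "represents n k Y \<Y>"
  shows "length (principal_angles n k \<X> \<Y>) = k"
    and "sorted (principal_angles n k \<X> \<Y>)"
    and "set (principal_angles n k \<X> \<Y>) \<subseteq> {0..pi / 2}"
    and "map cos (principal_angles n k \<X> \<Y>) = singular_values (Y\<^sup>T * X)"
proof -
  let ?S = "singular_values (Y\<^sup>T * X)"
  note pa = principal_angles_eq[OF X Y]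
  note b = singular_values_01[OF X Y]
  have "Y\<^sup>T * X \<in> carrier_mat k k" using X Y unfolding represents_def by auto
  then show "length (principal_angles n k \<X> \<Y>) = k" using pa length_singular_values by simp
  have "sorted_wrt (\<lambda>x y. y \<le> x) ?S"
    unfolding singular_values_def sorted_wrt_rev by (simp add: sorted_sorted_list_of_multiset)
  then have "sorted_wrt (\<lambda>x y. arccos x \<le> arccos y) ?S"
  proof (rule sorted_wrt_mono_rel[rotated])
    fix x y assume "x \<in> set ?S" "y \<in> set ?S" "y \<le> x"
    then show "arccos x \<le> arccos y" using b[of x] b[of y] by (intro arccos_le_arccos) auto
  qed
  then show "sorted (principal_angles n k \<X> \<Y>)" unfolding pa by (simp add: sorted_wrt_map)
  show "set (principal_angles n k \<X> \<Y>) \<subseteq> {0..pi / 2}"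
  proof
    fix t assume "t \<in> set (principal_angles n k \<X> \<Y>)"
    then obtain s where s: "s \<in> set ?S" "t = arccos s" unfolding pa by auto
    then show "t \<in> {0..pi / 2}"
      using b[OF s(1)] arccos_lbound[of s] arccos_le_arccos[of 0 s] by simp
  qed
  show "map cos (principal_angles n k \<X> \<Y>) = ?S"
  proof -
    have "cos (arccos s) = s" if "s \<in> set ?S" for s
      using b[OF that] by (intro cos_arccos) auto
    then show ?thesis unfolding pa by (simp add: map_idI)
  qed
qed

lemma represents_Gr:
  assumes X: "represents n k X \<X>"
  shows "\<X> \<in> Gr n k"
proof -
  interpret vec_space "TYPE(real)" n .
  have Xc: "X \<in> carrier_mat n k" "X\<^sup>T * X = 1\<^sub>m k" and sp: "span (set (cols X)) = \<X>"
    using X unfolding represents_def by auto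
  have cn: "set (cols X) \<subseteq> carrier_vec n" using Xc(1) cols_dim by blast
  have inj: "c = 0\<^sub>v k" if "c \<in> carrier_vec k" "X *\<^sub>v c = 0\<^sub>v n" for c
  proof -
    have "c = (X\<^sup>T * X) *\<^sub>v c" using that Xc by simp
    also have "\<dots> = X\<^sup>T *\<^sub>v (X *\<^sub>v c)" using that Xc(1) by (intro assoc_mult_mat_vec) auto
    also have "\<dots> = 0\<^sub>v k" using that Xc(1) by auto
    finally show ?thesis .
  qed
  have dist: "distinct (cols X)"
  proof (subst distinct_conv_nth, intro allI impI)
    fix i j assume ij: "i < length (cols X)" "j < length (cols X)" "i \<noteq> j"
    then have k: "i < k" "j < k" using Xc(1) by auto
    have "col X i \<bullet> col X l = (X\<^sup>T * X) $$ (i, l)" if "l < k" for l using k that Xc(1) by auto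
    then have "col X i \<bullet> col X i \<noteq> col X i \<bullet> col X j" using k ij(3) Xc(2) by simp
    then show "cols X ! i \<noteq> cols X ! j" using k Xc(1) by auto
  qed
  have "lin_indpt (set (cols X))"
  proof
    assume "lin_dep (set (cols X))"
    then obtain c where "c \<in> carrier_vec k" "c \<noteq> 0\<^sub>v k" "X *\<^sub>v c = 0\<^sub>v n"
      using lin_depE[OF Xc(1) _ dist] by metis
    then show False using inj by auto
  qed
  then have "rank X = k" using lin_indpt_full_rank[OF Xc(1) dist] by simp
  then show ?thesis
    unfolding Gr_def rank_def sp[symmetric] using span_is_subspace[OF cn] by auto
qed

lemma mat_trace_transpose_mult:
  assumes X: "X \<in> carrier_mat n k" and Y: "Y \<in> carrier_mat n k"
  shows "mat_trace (X\<^sup>T * Y) = (\<Sum>j<k. \<Sum>i<n. X $$ (i, j) * Y $$ (i, j))"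
  unfolding mat_trace_def using X Y by (auto simp: scalar_prod_def atLeast0LessThan intro!: sum.cong)

text \<open>The minimum of the objective over \<open>Gr n k\<close> is attained at the span of the first \<open>k\<close>
  eigenvectors and equals minus the sum of the \<open>k\<close> largest eigenvalues.\<close>

context
  fixes n k :: nat and A :: "real mat" and lam :: "nat \<Rightarrow> real" and v :: "nat \<Rightarrow> real vec"
  assumes kn: "1 \<le> k" "k \<le> n"
    and A: "A \<in> carrier_mat n n"
    and v: "\<And>i. i \<in> {1..n} \<Longrightarrow> v i \<in> carrier_vec n"
    and orthonormal:
      "\<And>i j. i \<in> {1..n} \<Longrightarrow> j \<in> {1..n} \<Longrightarrow> v i \<bullet> v j = (if i = j then 1 else 0)"
    and eigen: "\<And>i. i \<in> {1..n} \<Longrightarrow> A *\<^sub>v v i = lam i \<cdot>\<^sub>v v i"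
    and ordered: "\<And>i j. 1 \<le> i \<Longrightarrow> i \<le> j \<Longrightarrow> j \<le> n \<Longrightarrow> lam j \<le> lam i"
begin

lemma frame_represents:
  assumes "m \<le> n"
  shows
  "represents n m (mat_of_cols n (map v [1..<Suc m])) (real_span n (v ` {1..m}))"
proof -
  let ?vs = "map v [1..<Suc m]"
  let ?X = "mat_of_cols n ?vs"
  have vs: "set ?vs \<subseteq> carrier_vec n" using v assms by auto
  have nth: "?vs ! i = v (Suc i)" if "i < m" for i using that by (simp del: upt_Suc)
  have X: "?X \<in> carrier_mat n m" by (auto simp del: upt_Suc)
  have c: "cols ?X = ?vs" using vs by (rule cols_mat_of_cols)
  have "?X\<^sup>T * ?X = 1\<^sub>m m"
  proof (rule eq_matI)
    fix i j assume "i < dim_row (1\<^sub>m m)" "j < dim_col (1\<^sub>m m)"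
    then have ij: "i < m" "j < m" by auto
    have "(?X\<^sup>T * ?X) $$ (i, j) = col ?X i \<bullet> col ?X j" using ij X by auto
    also have "\<dots> = v (Suc i) \<bullet> v (Suc j)"
      using ij X c nth by (metis carrier_matD(2) cols_length cols_nth)
    also have "\<dots> = 1\<^sub>m m $$ (i, j)" using ij assms orthonormal[of "Suc i" "Suc j"] by auto
    finally show "(?X\<^sup>T * ?X) $$ (i, j) = 1\<^sub>m m $$ (i, j)" .
  qed (use X in auto)
  moreover have "set ?vs = v ` {1..m}" by auto
  ultimately show ?thesis unfolding represents_def using X c by simp
qed


lemma objective_leading:
  "objective n k A (real_span n (v ` {1..k})) = - (\<Sum>i=1..k. lam i)"
proof -
  define X where "X = mat_of_cols n (map v [1..<Suc k])"
  have R: "represents n k X (real_span n (v ` {1..k}))"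
    unfolding X_def using kn by (intro frame_represents)
  then have X: "X \<in> carrier_mat n k" unfolding represents_def by simp
  have c: "col X j = v (Suc j)" if "j < k" for j
    unfolding X_def using that v kn by (subst col_mat_of_cols) (auto simp del: upt_Suc)
  have "(X\<^sup>T * A * X) $$ (j, j) = lam (Suc j)" if j: "j < k" for j
  proof -
    have "(X\<^sup>T * A * X) $$ (j, j) = (X\<^sup>T * (A * X)) $$ (j, j)"
      using X A by (simp add: assoc_mult_mat[of _ k n _ n _ k])
    also have "\<dots> = col X j \<bullet> (A *\<^sub>v col X j)"
      using X A j by (simp add: mult_mat_vec_def)
    also have "\<dots> = lam (Suc j)"
      unfolding c[OF j] using eigen[of "Suc j"] orthonormal[of "Suc j" "Suc j"] v[of "Suc j"] j kn by simp
    finally show ?thesis .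
  qed
  then have "mat_trace (X\<^sup>T * A * X) = (\<Sum>j<k. lam (Suc j))" unfolding mat_trace_def using X by simp
  also have "\<dots> = (\<Sum>i=1..k. lam i)" by (simp add: sum.atLeast1_atMost_eq)
  finally show ?thesis using objective_eq[OF R A] by simp
qed

lemma objective_ge:
  assumes "\<X> \<in> Gr n k"
  shows "objective n k A \<X> \<ge> - (\<Sum>i=1..k. lam i)"
proof -
  obtain X where R: "represents n k X \<X>" using Gr_represented[OF assms] by auto
  have X: "X \<in> carrier_mat n k" "X\<^sup>T * X = 1\<^sub>m k" using R unfolding represents_def by auto
  define V where "V = mat_of_cols n (map v [1..<Suc n])"
  have V: "V \<in> carrier_mat n n" "V\<^sup>T * V = 1\<^sub>m n"
    using frame_represents[of n] unfolding represents_def V_def by auto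
  have VV: "V * V\<^sup>T = 1\<^sub>m n" using mat_mult_left_right_inverse[OF _ V(1) V(2)] V by auto
  have c: "col V j = v (Suc j)" if "j < n" for j
    unfolding V_def using that v by (subst col_mat_of_cols) (auto simp del: upt_Suc)
  define W where "W = V\<^sup>T * X"
  define D where "D = mat n k (\<lambda>(i, j). lam (Suc i) * W $$ (i, j))"
  have W: "W \<in> carrier_mat n k" and D: "D \<in> carrier_mat n k"
    unfolding W_def D_def using V X by auto
  have Wt: "W\<^sup>T = X\<^sup>T * V" unfolding W_def using V X by (simp add: transpose_mult[of _ n n])
  have XW: "X = V * W"
    unfolding W_def using V X VV by (simp flip: assoc_mult_mat[of _ n n _ n _ k])
  have WW: "W\<^sup>T * W = 1\<^sub>m k"
    unfolding Wt using V X W XW by (simp add: assoc_mult_mat[of _ k n _ n _ k])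
  have AV: "A * V = V * mat n n (\<lambda>(i, j). if i = j then lam (Suc i) else 0)" (is "_ = V * ?E")
  proof (rule eq_matI)
    fix i j assume "i < dim_row (V * ?E)" "j < dim_col (V * ?E)"
    then have ij: "i < n" "j < n" using V by auto
    have "(A * V) $$ (i, j) = (A *\<^sub>v col V j) $ i" using ij V A by simp
    also have "\<dots> = lam (Suc j) * V $$ (i, j)"
      using c[OF ij(2)] eigen[of "Suc j"] v[of "Suc j"] ij V(1)
      by (metis One_nat_def Suc_leI atLeastAtMost_iff carrier_matD carrier_vecD index_col index_smult_vec(1) le_add1 plus_1_eq_Suc)
    also have "\<dots> = (V * ?E) $$ (i, j)"
      using ij V by (simp add: scalar_prod_def if_distrib sum.delta cong: if_cong)
    finally show "(A * V) $$ (i, j) = (V * ?E) $$ (i, j)" .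
  qed (use A V in auto)
  have EW: "?E * W = D"
    unfolding D_def using W by (intro eq_matI) (auto simp: scalar_prod_def if_distrib if_distribR sum.delta' cong: if_cong)
  have "A * X = V * D"
  proof -
    have "A * X = (A * V) * W" unfolding XW using A V W by (simp add: assoc_mult_mat[of _ n n _ n _ k])
    also have "\<dots> = V * (?E * W)" unfolding AV using V W by (intro assoc_mult_mat) auto
    finally show ?thesis unfolding EW .
  qed
  then have "X\<^sup>T * A * X = W\<^sup>T * D"
    unfolding Wt using A V X D
    by (simp add: assoc_mult_mat[of _ k n _ n _ k])
  then have "mat_trace (X\<^sup>T * A * X) = (\<Sum>j<k. \<Sum>i<n. W $$ (i, j) * D $$ (i, j))"
    using mat_trace_transpose_mult[OF W D] by simp
  also have "\<dots> = (\<Sum>i<n. lam (Suc i) * (\<Sum>j<k. (W $$ (i, j))\<^sup>2))"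
    by (subst sum.swap) (auto simp: D_def sum_distrib_left power2_eq_square intro!: sum.cong)
  finally have trp: "mat_trace (X\<^sup>T * A * X) = (\<Sum>i<n. lam (Suc i) * (\<Sum>j<k. (W $$ (i, j))\<^sup>2))" .
  define p where "p i = (\<Sum>j<k. (W $$ (i, j))\<^sup>2)" for i
  have p0: "p i \<ge> 0" for i unfolding p_def by (auto intro: sum_nonneg)
  have "mat_trace (1\<^sub>m k) = real k" unfolding mat_trace_def by simp
  then have psum: "(\<Sum>i<n. p i) = k"
    using mat_trace_transpose_mult[OF W W] unfolding WW p_def
    by (subst sum.swap) (simp add: power2_eq_square)
  have p1: "p i \<le> 1" if i: "i < n" for i
  proof -
    let ?H = "W * W\<^sup>T"
    have H: "?H \<in> carrier_mat n n" using W by auto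
    have HH: "?H * ?H = ?H"
    proof -
      have "?H * ?H = W * (W\<^sup>T * W) * W\<^sup>T"
        using W by (simp add: assoc_mult_mat[of _ n k _ n _ n] assoc_mult_mat[of _ n k _ k _ n]
            assoc_mult_mat[of _ k n _ k _ n])
      then show ?thesis using W WW by simp
    qed
    have Hii: "?H $$ (i, i) = p i"
      using i W by (simp add: scalar_prod_def p_def power2_eq_square atLeast0LessThan)
    have sym: "?H $$ (i, l) = ?H $$ (l, i)" if "l < n" for l
      using i that W by (simp add: scalar_prod_def mult.commute)
    have "p i = (\<Sum>l<n. ?H $$ (i, l) * ?H $$ (l, i))"
      using arg_cong[OF HH, of "\<lambda>M. M $$ (i, i)"] H i Hii
      by (subst (asm) index_mult_mat(1)) (auto simp: scalar_prod_def atLeast0LessThan simp del: index_mult_mat)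
    also have "\<dots> = (\<Sum>l<n. (?H $$ (i, l))\<^sup>2)"
      by (intro sum.cong refl) (metis sym lessThan_iff power2_eq_square)
    also have "\<dots> \<ge> (?H $$ (i, i))\<^sup>2" using i by (intro member_le_sum) auto
    finally have "(p i)\<^sup>2 \<le> p i" unfolding Hii .
    then show ?thesis
      using mult_strict_left_mono[of 1 "p i" "p i"] unfolding power2_eq_square by linarith
  qed
  have "(\<Sum>i<n. lam (Suc i) * p i) - (\<Sum>i<k. lam (Suc i))
      = (\<Sum>i<n. lam (Suc i) * (p i - (if i < k then 1 else 0)))"
  proof -
    have "(\<Sum>i<n. lam (Suc i) * (if i < k then 1 else 0)) = (\<Sum>i<k. lam (Suc i))"
      using kn by (intro sum.mono_neutral_cong_right) auto
    then show ?thesis by (simp add: right_diff_distrib sum_subtractf)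
  qed
  also have "\<dots> \<le> (\<Sum>i<n. lam k * (p i - (if i < k then 1 else 0)))"
  proof (intro sum_mono)
    fix i assume "i \<in> {..<n}"
    then have i: "i < n" by simp
    show "lam (Suc i) * (p i - (if i < k then 1 else 0)) \<le> lam k * (p i - (if i < k then 1 else 0))"
    proof (cases "i < k")
      case True
      then show ?thesis using ordered[of "Suc i" k] kn p1[OF i] by (simp add: mult_right_mono_neg)
    next
      case False
      then show ?thesis using ordered[of k "Suc i"] i kn p0[of i] by (simp add: mult_right_mono)
    qed
  qed
  also have "\<dots> = lam k * ((\<Sum>i<n. p i) - (\<Sum>i<n. if i < k then 1 else 0))"
    by (simp add: sum_distrib_left sum_subtractf right_diff_distrib)
  also have "(\<Sum>i<n. if i < k then 1 else 0) = (\<Sum>i<k. 1::real)"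
    using kn by (intro sum.mono_neutral_cong_right) auto
  finally have "(\<Sum>i<n. lam (Suc i) * p i) \<le> (\<Sum>i<k. lam (Suc i))" using psum by simp
  then show ?thesis
    unfolding objective_eq[OF R A] trp p_def by (simp add: sum.atLeast1_atMost_eq)
qed

lemma leading_in_Gr: "real_span n (v ` {1..k}) \<in> Gr n k"
  using represents_Gr[OF frame_represents] kn by simp

end


end

theory Submission
  imports
    "HOL-Analysis.Gamma_Function"
    "HOL-Real_Asymp.Real_Asymp"
    Defs
begin

(* The dot denotes scalar_prod, the product of vectors of explicit dimension. *)
unbundle no inner_syntax

text \<open>
  The difference \<open>f(\<X>) - f\<^sup>*\<close> is bounded below by \<open>\<delta> \<Sum> sin\<^sup>2 \<theta>\<^sub>i\<close>, and Jordan's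
  inequality \<open>sin \<theta> \<ge> 2 \<theta> / \<pi>\<close> on \<open>[0, \<pi>/2]\<close> turns this into
  \<open>(4 / \<pi>\<^sup>2) \<delta> \<Sum> \<theta>\<^sub>i\<^sup>2\<close>.

  For the first bound, let \<open>P\<close> be the orthogonal projector onto \<open>\<V>\<^sub>\<alpha>\<close> and deflate: the matrix
  \<open>A - \<delta> P\<close> has the eigenvectors of \<open>A\<close>, with the \<open>k\<close> leading eigenvalues lowered by \<open>\<delta>\<close> and the
  others unchanged. As \<open>\<delta>\<close> is the spectral gap, the lowered eigenvalues are still the largest ones.
  Hence the trace minimum (\<open>objective_ge\<close>) applies to \<open>A - \<delta> P\<close> and says
  \<open>- Tr (X\<^sup>T A X) + \<delta> Tr (X\<^sup>T P X) \<ge> f\<^sup>* + k \<delta>\<close>. It remains to see that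
  \<open>Tr (X\<^sup>T P X) = \<Sum> cos\<^sup>2 \<theta>\<^sub>i\<close>: if \<open>P = Y Y\<^sup>T\<close>, this is the trace of the Gram
  matrix of \<open>Y\<^sup>T X\<close>, which is the sum of its eigenvalues (\<open>mat_trace_eq_sum_roots\<close>), the squared
  singular values.

  The numerical bound \<open>4 / \<pi>\<^sup>2 > 0.4\<close> is \<open>\<pi>\<^sup>2 < 10\<close>, which follows from
  \<open>\<pi>\<^sup>2 / 6 = \<Sum> 1 / n\<^sup>2\<close>.
\<close>

text \<open>The sine is concave on \<open>[0, \<pi>/2]\<close>, so it lies above its chord there.\<close>

lemma jordan_sin_ge:
  fixes x :: real
  assumes "0 \<le> x" "x \<le> pi / 2"
  shows "2 / pi * x \<le> sin x"
proof -
  have "concave_on {0..pi / 2} (sin :: real \<Rightarrow> real)"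
    by (rule f''_le0_imp_concave[where f' = cos and f'' = "\<lambda>x. - sin x"])
      (auto intro!: derivative_eq_intros sin_ge_zero)
  from concave_onD[OF this, of "2 / pi * x" 0 "pi / 2"] assms show ?thesis
    by (simp add: field_simps)
qed

text \<open>After the first two terms of \<open>\<Sum> 1 / n\<^sup>2\<close>, each term is majorised by
  \<open>1 / (n - 1/2) - 1 / (n + 1/2)\<close>, which telescopes to \<open>2/5\<close>; this suffices because
  \<open>6 (1 + 1/4 + 2/5) = 9.9\<close>.\<close>

lemma pi_squared_less_10: "pi\<^sup>2 < 10"
proof -
  define g :: "nat \<Rightarrow> real" where "g n = 1 / (of_nat n + 5 / 2)" for n
  have "(\<lambda>n. 1 / (of_nat n + 1)\<^sup>2) sums (pi\<^sup>2 / 6)"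
    using inverse_squares_sums by (simp add: add.commute)
  from sums_split_initial_segment[OF this, of 2]
  have tail: "(\<lambda>n. 1 / (real n + 3)\<^sup>2) sums (pi\<^sup>2 / 6 - 5 / 4)"
    by (simp add: eval_nat_numeral algebra_simps)
  have "g \<longlonglongrightarrow> 0"
    unfolding g_def by real_asymp
  from telescope_sums'[OF this] have tel: "(\<lambda>n. g n - g (Suc n)) sums (2 / 5)"
    by (simp add: g_def)
  have "1 / (real n + 3)\<^sup>2 \<le> g n - g (Suc n)" for n
    by (simp add: g_def divide_simps) (simp add: power2_eq_square algebra_simps)
  from sums_le[OF this tail tel] show ?thesis
    by simp
qed

text \<open>The trace is invariant under similarity, so it can be read off from the Schur form, whose
  diagonal is the list of roots.\<close>

lemma mat_trace_eq_sum_roots: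
  fixes G :: "real mat"
  assumes G: "G \<in> carrier_mat k k" and es: "char_poly G = (\<Prod>e\<leftarrow>es. [:- e, 1:])"
  shows "mat_trace G = sum_list es"
proof -
  obtain B P Q where "schur_decomposition G es = (B, P, Q)"
    by (rule prod_cases3)
  note schur = schur_decomposition[OF G es this]
  have diag: "diag_mat B = es" using schur by blast
  note w = similar_mat_witD2[OF G conjunct1[OF schur]]
  have "mat_trace G = mat_trace (P * (B * Q))"
    unfolding w(3) by (simp only: assoc_mult_mat[OF w(6) w(5) w(7)])
  also have "\<dots> = mat_trace (B * Q * P)"
    by (rule mat_trace_comm[OF w(6) mult_carrier_mat[OF w(5) w(7)]])
  also have "B * Q * P = B"
    by (simp only: assoc_mult_mat[OF w(5) w(7) w(6)] w(2) right_mult_one_mat[OF w(5)])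
  also have "mat_trace B = sum_list (diag_mat B)"
    unfolding mat_trace_def diag_mat_def
    by (simp add: interv_sum_list_conv_sum_set_nat atLeast0LessThan)
  finally show ?thesis unfolding diag .
qed

lemma mat_trace_gram_singular_values:
  fixes M :: "real mat"
  assumes M: "M \<in> carrier_mat m k"
  shows "mat_trace (M\<^sup>T * M) = (\<Sum>s\<leftarrow>singular_values M. s\<^sup>2)"
proof -
  obtain es where es: "char_poly (M\<^sup>T * M) = (\<Prod>e\<leftarrow>es. [:- e, 1:])"
    and "length es = k" and nonneg: "\<And>e. e \<in> set es \<Longrightarrow> 0 \<le> e"
    using gram_char_poly_splits[OF M] by blast
  have "mset (singular_values M) = image_mset sqrt (mset es)"
    unfolding singular_values_def es proots_linear_factors by simp
  then have "(\<Sum>s\<leftarrow>singular_values M. s\<^sup>2) = sum_mset (image_mset (\<lambda>s. s\<^sup>2) (image_mset sqrt (mset es)))"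
    by (simp only: mset_map flip: sum_mset_sum_list)
  also have "\<dots> = (\<Sum>e\<leftarrow>es. (sqrt e)\<^sup>2)"
    by (simp add: image_mset.compositionality o_def flip: sum_mset_sum_list)
  also have "\<dots> = sum_list es"
    using nonneg by (simp add: map_idI)
  also have "\<dots> = mat_trace (M\<^sup>T * M)"
    by (rule mat_trace_eq_sum_roots[OF _ es, of k, symmetric]) (use M in auto)
  finally show ?thesis ..
qed

text \<open>The cosines of the angles are the singular values of \<open>Y\<^sup>T X\<close>, so their squares sum to the
  trace of its Gram matrix, and there are \<open>k\<close> of them.\<close>

lemma sum_sin_squared_principal_angles:
  assumes X: "represents n k X \<X>" and Y: "represents n k Y \<Y>"
  shows "(\<Sum>\<theta>\<leftarrow>principal_angles n k \<X> \<Y>. (sin \<theta>)\<^sup>2) = real k - mat_trace ((Y\<^sup>T * X)\<^sup>T * (Y\<^sup>T * X))"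
proof -
  let ?pa = "principal_angles n k \<X> \<Y>"
  have M: "Y\<^sup>T * X \<in> carrier_mat k k"
    using X Y unfolding represents_def by auto
  have "mat_trace ((Y\<^sup>T * X)\<^sup>T * (Y\<^sup>T * X)) = (\<Sum>s\<leftarrow>map cos ?pa. s\<^sup>2)"
    unfolding principal_angles_props(4)[OF X Y] by (rule mat_trace_gram_singular_values[OF M])
  moreover have "(\<Sum>\<theta>\<leftarrow>?pa. (sin \<theta>)\<^sup>2) = (\<Sum>\<theta>\<leftarrow>?pa. 1 - (cos \<theta>)\<^sup>2)"
    by (simp add: sin_squared_eq)
  ultimately show ?thesis
    using principal_angles_props(1)[OF X Y]
    by (simp add: sum_list_subtractf o_def sum_list_triv)
qed

lemma four_gr_dist_squared_le:
  assumes X: "represents n k X \<X>" and Y: "represents n k Y \<Y>"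
  shows "4 / pi\<^sup>2 * (gr_dist n k \<X> \<Y>)\<^sup>2 \<le> (\<Sum>\<theta>\<leftarrow>principal_angles n k \<X> \<Y>. (sin \<theta>)\<^sup>2)"
proof -
  let ?pa = "principal_angles n k \<X> \<Y>"
  have "(gr_dist n k \<X> \<Y>)\<^sup>2 = (\<Sum>\<theta>\<leftarrow>?pa. \<theta>\<^sup>2)"
    unfolding gr_dist_def by (intro real_sqrt_pow2 sum_list_nonneg) auto
  then have "4 / pi\<^sup>2 * (gr_dist n k \<X> \<Y>)\<^sup>2 = (\<Sum>\<theta>\<leftarrow>?pa. (2 / pi * \<theta>)\<^sup>2)"
    by (simp add: power_mult_distrib power_divide flip: sum_list_const_mult)
  also have "\<dots> \<le> (\<Sum>\<theta>\<leftarrow>?pa. (sin \<theta>)\<^sup>2)"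
  proof (intro sum_list_mono power_mono)
    fix \<theta> assume "\<theta> \<in> set ?pa"
    then have \<theta>: "0 \<le> \<theta>" "\<theta> \<le> pi / 2"
      using principal_angles_props(3)[OF X Y] by auto
    then show "2 / pi * \<theta> \<le> sin \<theta>" by (rule jordan_sin_ge)
    show "0 \<le> 2 / pi * \<theta>" using \<theta> by simp
  qed
  finally show ?thesis .
qed

lemma objective_deflated:
  assumes X: "represents n k X \<X>" and A: "A \<in> carrier_mat n n" and Y: "Y \<in> carrier_mat n m"
  shows "objective n k (A - d \<cdot>\<^sub>m (Y * Y\<^sup>T)) \<X> =
    objective n k A \<X> + d * mat_trace ((Y\<^sup>T * X)\<^sup>T * (Y\<^sup>T * X))"
proof -
  have Xc: "X \<in> carrier_mat n k" using X unfolding represents_def by simp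
  let ?P = "Y * Y\<^sup>T"
  have P: "?P \<in> carrier_mat n n" using Y by auto
  have gram: "(Y\<^sup>T * X)\<^sup>T * (Y\<^sup>T * X) = X\<^sup>T * ?P * X"
    using Xc Y by (simp add: transpose_mult[of _ m n _ k] assoc_mult_mat[of _ k n _ m _ k]
        assoc_mult_mat[of _ k n _ n _ k] assoc_mult_mat[of _ n m _ n _ k])
  have "X\<^sup>T * (A - d \<cdot>\<^sub>m ?P) * X = X\<^sup>T * A * X - d \<cdot>\<^sub>m (X\<^sup>T * ?P * X)"
    using Xc A P
    by (simp add: mult_minus_distrib_mat[of _ k n _ n] minus_mult_distrib_mat[of _ k n _ _ k]
        mult_smult_distrib[of _ k n _ n] mult_smult_assoc_mat[of _ k n _ k])
  then have "mat_trace (X\<^sup>T * (A - d \<cdot>\<^sub>m ?P) * X) = mat_trace (X\<^sup>T * A * X) - d * mat_trace (X\<^sup>T * ?P * X)"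
    using Xc A P unfolding mat_trace_def
    by (simp add: sum_subtractf sum_distrib_left del: index_mult_mat(1))
  then show ?thesis
    unfolding gram objective_eq[OF X A] objective_eq[OF X minus_carrier_mat[OF smult_carrier_mat[OF P]]]
    by simp
qed

lemma projector_mult_orthonormal:
  assumes kn: "k \<le> n"
    and v: "\<And>i. i \<in> {1..n} \<Longrightarrow> v i \<in> carrier_vec n"
    and orthonormal:
      "\<And>i j. i \<in> {1..n} \<Longrightarrow> j \<in> {1..n} \<Longrightarrow> v i \<bullet> v j = (if i = j then 1 else (0 :: real))"
    and i: "i \<in> {1..n}"
  defines "Y \<equiv> mat_of_cols n (map v [1..<Suc k])"
  shows "Y * Y\<^sup>T *\<^sub>v v i = (if i \<le> k then v i else 0\<^sub>v n)"
proof -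
  have Y: "Y \<in> carrier_mat n k" unfolding Y_def by (auto simp del: upt_Suc)
  have c: "col Y j = v (Suc j)" if "j < k" for j
    unfolding Y_def using that v kn by (subst col_mat_of_cols) (auto simp del: upt_Suc)
  have coord: "Y\<^sup>T *\<^sub>v v i = (if i \<le> k then unit_vec k (i - 1) else 0\<^sub>v k)"
    using Y i kn by (intro eq_vecI) (auto simp: c orthonormal)
  have "Y *\<^sub>v unit_vec k (i - 1) = v i" if "i \<le> k"
  proof -
    have "Y *\<^sub>v unit_vec k (i - 1) = col Y (i - 1)"
      using Y i that by (intro eq_vecI) (auto simp: scalar_prod_right_unit)
    also have "\<dots> = v (Suc (i - 1))" using i that by (intro c) auto
    finally show ?thesis using i by simp
  qed
  moreover have "Y * Y\<^sup>T *\<^sub>v v i = Y *\<^sub>v (Y\<^sup>T *\<^sub>v v i)"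
    using Y v[OF i] by (intro assoc_mult_mat_vec) auto
  ultimately show ?thesis unfolding coord using Y by auto
qed

text \<open>Compare \<open>A\<close> with \<open>A - \<delta> Y Y\<^sup>T\<close>, where the columns of \<open>Y\<close> are the leading
  eigenvectors: the minimum of the objective rises by \<open>k \<delta>\<close>, while its value at \<open>\<X>\<close> rises only
  by \<open>\<delta> \<Sum> cos\<^sup>2 \<theta>\<^sub>i\<close>. As the value stays above the minimum, it exceeded the old minimum
  by at least the difference of the two rises.\<close>

lemma objective_gap_ge_sum_sin_squared:
  assumes k: "1 \<le> k" "k < n"
    and A: "A \<in> carrier_mat n n"
    and v: "\<And>i. i \<in> {1..n} \<Longrightarrow> v i \<in> carrier_vec n"
    and orthonormal:
      "\<And>i j. i \<in> {1..n} \<Longrightarrow> j \<in> {1..n} \<Longrightarrow> v i \<bullet> v j = (if i = j then 1 else 0)"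
    and eigen: "\<And>i. i \<in> {1..n} \<Longrightarrow> A *\<^sub>v v i = lam i \<cdot>\<^sub>v v i"
    and ordered: "\<And>i j. 1 \<le> i \<Longrightarrow> i \<le> j \<Longrightarrow> j \<le> n \<Longrightarrow> lam j \<le> lam i"
    and \<X>: "\<X> \<in> Gr n k"
  shows "(lam k - lam (k + 1)) * (\<Sum>\<theta>\<leftarrow>principal_angles n k \<X> (real_span n (v ` {1..k})). (sin \<theta>)\<^sup>2)
    \<le> objective n k A \<X> - (- (\<Sum>i = 1..k. lam i))"
proof -
  have kn: "k \<le> n" using k by simp
  define \<delta> where "\<delta> = lam k - lam (k + 1)"
  define Y where "Y = mat_of_cols n (map v [1..<Suc k])"
  define A' where "A' = A - \<delta> \<cdot>\<^sub>m (Y * Y\<^sup>T)"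
  define lam' where "lam' i = (if i \<le> k then lam i - \<delta> else lam i)" for i
  obtain X where X: "represents n k X \<X>" using Gr_represented[OF \<X>] by auto
  have Y: "represents n k Y (real_span n (v ` {1..k}))"
    unfolding Y_def by (rule frame_represents[OF k(1) kn A v orthonormal eigen ordered kn])
  then have Yc: "Y \<in> carrier_mat n k" unfolding represents_def by simp
  then have P: "Y * Y\<^sup>T \<in> carrier_mat n n" by auto
  have A': "A' \<in> carrier_mat n n" unfolding A'_def by (intro minus_carrier_mat smult_carrier_mat P)
  have eigen': "A' *\<^sub>v v i = lam' i \<cdot>\<^sub>v v i" if i: "i \<in> {1..n}" for i
  proof -
    have proj: "Y * Y\<^sup>T *\<^sub>v v i = (if i \<le> k then v i else 0\<^sub>v n)"
      unfolding Y_def by (rule projector_mult_orthonormal[OF kn v orthonormal i])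
    have "(\<delta> \<cdot>\<^sub>m (Y * Y\<^sup>T)) *\<^sub>v v i = \<delta> \<cdot>\<^sub>v (Y * Y\<^sup>T *\<^sub>v v i)"
      using P v[OF i] by (intro eq_vecI) auto
    then have "A' *\<^sub>v v i = A *\<^sub>v v i - \<delta> \<cdot>\<^sub>v (Y * Y\<^sup>T *\<^sub>v v i)"
      unfolding A'_def using A P v[OF i]
      by (simp add: minus_mult_distrib_mat_vec[of _ n n])
    also have "\<dots> = lam' i \<cdot>\<^sub>v v i"
      unfolding eigen[OF i] proj lam'_def
      using v[OF i] by (intro eq_vecI) (auto simp: left_diff_distrib)
    finally show ?thesis .
  qed
  \<comment> \<open>Lowering by the gap only makes the \<open>k\<close>-th eigenvalue equal to the next one.\<close>
  have ordered': "lam' j \<le> lam' i" if "1 \<le> i" "i \<le> j" "j \<le> n" for i j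
    using that ordered[of i j] ordered[of i k] ordered[of "k + 1" j] k
    unfolding lam'_def \<delta>_def by auto
  have "(\<Sum>i = 1..k. lam' i) = (\<Sum>i = 1..k. lam i) - real k * \<delta>"
    by (simp add: lam'_def sum_subtractf)
  moreover have "- (\<Sum>i = 1..k. lam' i) \<le> objective n k A' \<X>"
    by (rule objective_ge[OF k(1) kn A' v orthonormal eigen' ordered' \<X>])
  ultimately show ?thesis
    unfolding A'_def objective_deflated[OF X A Yc] sum_sin_squared_principal_angles[OF X Y]
      \<delta>_def[symmetric]
    by (simp add: algebra_simps)
qed

theorem proposition6:
  fixes n k :: nat and A :: "real mat"
    and lam :: "nat \<Rightarrow> real" and v :: "nat \<Rightarrow> real vec"
    and \<X> \<V>\<^sub>\<alpha> :: "real vec set" and \<delta> fstar c\<^sub>Q :: real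
  assumes k: "1 \<le> k" "k \<le> n - 1"
    and A: "A \<in> carrier_mat n n"
    and sym: "A\<^sup>T = A"
    and psd: "\<And>x. x \<in> carrier_vec n \<Longrightarrow> 0 \<le> x \<bullet> (A *\<^sub>v x)"
    and v: "\<And>i. i \<in> {1..n} \<Longrightarrow> v i \<in> carrier_vec n"
    and orthonormal:
      "\<And>i j. i \<in> {1..n} \<Longrightarrow> j \<in> {1..n} \<Longrightarrow> v i \<bullet> v j = (if i = j then 1 else 0)"
    and eigen: "\<And>i. i \<in> {1..n} \<Longrightarrow> A *\<^sub>v v i = lam i \<cdot>\<^sub>v v i"
    and ordered: "\<And>i j. 1 \<le> i \<Longrightarrow> i \<le> j \<Longrightarrow> j \<le> n \<Longrightarrow> lam j \<le> lam i"
  defines "\<delta> \<equiv> lam k - lam (k + 1)"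
    and "\<V>\<^sub>\<alpha> \<equiv> real_span n (v ` {1..k})"
    and "fstar \<equiv> - (\<Sum>i = 1..k. lam i)"
    and "c\<^sub>Q \<equiv> 4 / pi\<^sup>2"
  assumes \<X>: "\<X> \<in> Gr n k"
    and angles: "\<And>\<theta>. \<theta> \<in> set (principal_angles n k \<X> \<V>\<^sub>\<alpha>) \<Longrightarrow> \<theta> < pi / 2"
  shows "objective n k A \<X> - fstar \<ge> c\<^sub>Q * \<delta> * (gr_dist n k \<X> \<V>\<^sub>\<alpha>)\<^sup>2 \<and> c\<^sub>Q > 0.4"
proof
  have kn: "k < n" "k \<le> n" using k by auto
  obtain X where X: "represents n k X \<X>" using Gr_represented[OF \<X>] by auto
  have Y: "represents n k (mat_of_cols n (map v [1..<Suc k])) \<V>\<^sub>\<alpha>"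
    unfolding \<V>\<^sub>\<alpha>_def
    by (rule frame_represents[OF k(1) kn(2) A v orthonormal eigen ordered kn(2)])
  have "0 \<le> \<delta>" unfolding \<delta>_def using ordered[of k "k + 1"] k by simp
  then have "c\<^sub>Q * \<delta> * (gr_dist n k \<X> \<V>\<^sub>\<alpha>)\<^sup>2 \<le> \<delta> * (\<Sum>\<theta>\<leftarrow>principal_angles n k \<X> \<V>\<^sub>\<alpha>. (sin \<theta>)\<^sup>2)"
    using mult_left_mono[OF four_gr_dist_squared_le[OF X Y], of \<delta>]
    unfolding c\<^sub>Q_def by (simp add: mult_ac)
  also have "\<dots> \<le> objective n k A \<X> - fstar"
    unfolding \<delta>_def \<V>\<^sub>\<alpha>_def fstar_def
    by (rule objective_gap_ge_sum_sin_squared[OF k(1) kn(1) A v orthonormal eigen ordered \<X>])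
  finally show "objective n k A \<X> - fstar \<ge> c\<^sub>Q * \<delta> * (gr_dist n k \<X> \<V>\<^sub>\<alpha>)\<^sup>2" .
  show "c\<^sub>Q > 0.4"
    unfolding c\<^sub>Q_def using pi_squared_less_10 by (simp add: field_simps)
qed

end
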